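(* Let $P\in\mathcal{P}_{k,n}$ be a weakly column decreasing profile. Then $P$ is canonical if and only if any two rows of $P$ are interlacing.
   Context: Fix $n\ge 4$, $1\le k\le n/2$, $[n]=\{1,\dots,n\}$. $\mathcal{P}_{k,n}$ is the set of profiles of indecomposable modules in the Grassmannian cluster category $\mathrm{CM}(B_{k,n})$, where: $Q_C$ is the quiver with vertices $\mathbb{Z}/n$ and arrows $x_i:i-1\to i$, $y_i:i\to i-1$; $B_{k,n}$ is the quotient of the completed path algebra $\widehat{\mathbb{C}Q_C}$ by the relations $xy=yx$, $x^k=y^{n-k}$ at each vertex, with centre $Z=\mathbb{C}[[t]]$, $t=\sum_i x_iy_i$; $\mathrm{CM}(B_{k,n})$ consists of the modules $(M_i)$ with all $M_i$ free over $Z$ of the same finite rank. For a $k$-subset $I$, $L_I$ is the rank 1 module with $\mathbb{C}[[t]]$ at each vertex, $x_i=1,y_i=t$ if $i\in I$ and $x_i=t,y_i=1$ if $i\notin I$. A rank $m$ module has a filtration with rank 1 factors $L_{I_1},\dots,L_{I_m}$ from top to bottom ($L_{I_m}$ a submodule), and its profile is the ordered collection $I_1|\cdots|I_m$ of $k$-subsets in its generic filtration. In terms of the lattice diagram of $M$, where $M$ is given by a configuration of subspaces of $\mathbb{C}^m$ attached to the lattice points, the rims of $L_{I_1},\dots,L_{I_m}$ are the contours separating the regions of different multiplicity (dimension): $1$ between the top two rims, and so on, up to $m$ below the lowest rim. In particular a profile with $m$ rows is an ordered collection of $m$ $k$-subsets of $[n]$ (rows). Write a profile with $m$ rows as $P=(P_{ij})_{1\le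 i\le m,1\le j\le k}$ with each row in increasing order. $P$ is weakly column decreasing if $P_{i,j}\ge P_{i+1,j}$ for every $j\in[k]$, $i\in[m-1]$. $P$ is canonical if it is weakly column decreasing and $P_{m,j}\ge P_{1,j-1}$ for all $2\le j\le k$. Two sets $J_1,J_2$ of integers are $r$-interlacing if $|J_1\setminus J_2|=|J_2\setminus J_1|=r$ and, writing $J_1\setminus J_2=\{a_1<\dots<a_r\}$, $J_2\setminus J_1=\{b_1<\dots<b_r\}$, either $a_1<b_1<a_2<b_2<\dots<a_r<b_r$ or $b_1<a_1<b_2<a_2<\dots<b_r<a_r$ (equal sets are $0$-interlacing). They are interlacing if they are $r$-interlacing for some $r\ge 0$. *)

theory Defs
  imports
    "HOL-Computational_Algebra.Formal_Laurent_Series"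
    "HOL-Number_Theory.Cong"
    "Jordan_Normal_Form.Matrix"
begin

section \<open>The Grassmannian cluster category\<close>

text \<open>
  Write \<open>Z = \<complex>[[t]]\<close> and \<open>K = \<complex>((t))\<close>.  Families indexed by \<open>\<int>/n\<close> are
  represented by \<open>n\<close>-periodic families on \<open>\<int>\<close>.  An object of \<open>CM(B\<^sub>k\<^sub>,\<^sub>n)\<close> is free of the
  same finite rank \<open>m\<close> over \<open>Z\<close> at each vertex; after choosing bases the space at each vertex
  is \<open>Z\<^sup>m\<close> and the arrows \<open>x\<^sub>i : i - 1 \<rightarrow> i\<close> and \<open>y\<^sub>i : i \<rightarrow> i - 1\<close> act by
  \<open>m \<times> m\<close> matrices over \<open>Z\<close>.
\<close>

record cm_rep =
  rk :: nat
  xarr :: "int \<Rightarrow> complex fps mat"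
  yarr :: "int \<Rightarrow> complex fps mat"

definition periodic :: "nat \<Rightarrow> (int \<Rightarrow> 'a) \<Rightarrow> bool" where
  "periodic n f \<longleftrightarrow> (\<forall>i. f (i + int n) = f i)"

text \<open>The action of the paths \<open>x\<^sup>l : i \<rightarrow> i + l\<close> and \<open>y\<^sup>l : i \<rightarrow> i - l\<close>.\<close>

primrec xpath :: "cm_rep \<Rightarrow> int \<Rightarrow> nat \<Rightarrow> complex fps mat" where
  "xpath M i 0 = 1\<^sub>m (rk M)"
| "xpath M i (Suc l) = xarr M (i + int l + 1) * xpath M i l"

primrec ypath :: "cm_rep \<Rightarrow> int \<Rightarrow> nat \<Rightarrow> complex fps mat" where
  "ypath M i 0 = 1\<^sub>m (rk M)"
| "ypath M i (Suc l) = yarr M (i - int l) * ypath M i l"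

text \<open>
  The central element \<open>t = \<Sum>\<^sub>i x\<^sub>i y\<^sub>i\<close> acts at every vertex as multiplication by the power
  series variable, which together with \<open>xy = yx\<close> gives the first two relations.  The paths
  \<open>x\<^sup>k\<close> and \<open>y\<^sup>n\<^sup>-\<^sup>k\<close> starting at \<open>i\<close> end at \<open>i + k\<close> and \<open>i + k - n\<close>, the same vertex.
\<close>

definition CM :: "nat \<Rightarrow> nat \<Rightarrow> cm_rep set" where
  "CM k n = {M. periodic n (xarr M) \<and> periodic n (yarr M) \<and>
     (\<forall>i. xarr M i \<in> carrier_mat (rk M) (rk M) \<and> yarr M i \<in> carrier_mat (rk M) (rk M)) \<and>
     (\<forall>i. xarr M i * yarr M i = fps_X \<cdot>\<^sub>m 1\<^sub>m (rk M)) \<and>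
     (\<forall>i. yarr M i * xarr M i = fps_X \<cdot>\<^sub>m 1\<^sub>m (rk M)) \<and>
     (\<forall>i. xpath M i k = ypath M i (n - k))}"

definition cm_iso :: "nat \<Rightarrow> cm_rep \<Rightarrow> cm_rep \<Rightarrow> bool" where
  "cm_iso n M N \<longleftrightarrow> rk M = rk N \<and>
     (\<exists>\<phi> :: int \<Rightarrow> complex fps mat. periodic n \<phi> \<and>
        (\<forall>i. \<phi> i \<in> carrier_mat (rk M) (rk M) \<and> invertible_mat (\<phi> i) \<and>
           \<phi> i * xarr M i = xarr N i * \<phi> (i - 1) \<and>
           \<phi> (i - 1) * yarr M i = yarr N i * \<phi> i))"

definition block_diag :: "'a :: zero mat \<Rightarrow> 'a mat \<Rightarrow> 'a mat" where
  "block_diag A B =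
     four_block_mat A (0\<^sub>m (dim_row A) (dim_col B)) (0\<^sub>m (dim_row B) (dim_col A)) B"

definition cm_sum :: "cm_rep \<Rightarrow> cm_rep \<Rightarrow> cm_rep" where
  "cm_sum M N = \<lparr>rk = rk M + rk N,
     xarr = (\<lambda>i. block_diag (xarr M i) (xarr N i)),
     yarr = (\<lambda>i. block_diag (yarr M i) (yarr N i))\<rparr>"

text \<open>
  Direct summands of objects of \<open>CM(B\<^sub>k\<^sub>,\<^sub>n)\<close> are again objects of \<open>CM(B\<^sub>k\<^sub>,\<^sub>n)\<close>, so it suffices to
  consider decompositions inside this category.
\<close>

definition indecomposable :: "nat \<Rightarrow> nat \<Rightarrow> cm_rep \<Rightarrow> bool" where
  "indecomposable k n M \<longleftrightarrow> M \<in> CM k n \<and> rk M > 0 \<and>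
     \<not> (\<exists>M1 \<in> CM k n. \<exists>M2 \<in> CM k n. rk M1 > 0 \<and> rk M2 > 0 \<and> cm_iso n M (cm_sum M1 M2))"

definition k_subset :: "nat \<Rightarrow> nat \<Rightarrow> int set \<Rightarrow> bool" where
  "k_subset k n I \<longleftrightarrow> I \<subseteq> {1..int n} \<and> card I = k"

definition rank_one :: "nat \<Rightarrow> int set \<Rightarrow> cm_rep" where
  "rank_one n I = \<lparr>rk = 1,
     xarr = (\<lambda>i. (if \<exists>j\<in>I. [i = j] (mod int n) then 1 else fps_X) \<cdot>\<^sub>m 1\<^sub>m 1),
     yarr = (\<lambda>i. (if \<exists>j\<in>I. [i = j] (mod int n) then fps_X else 1) \<cdot>\<^sub>m 1\<^sub>m 1)\<rparr>"

section \<open>Filtrations with rank one factors\<close>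

definition cm_submodule :: "nat \<Rightarrow> cm_rep \<Rightarrow> (int \<Rightarrow> complex fps vec set) \<Rightarrow> bool" where
  "cm_submodule n M N \<longleftrightarrow> periodic n N \<and>
     (\<forall>i. N i \<subseteq> carrier_vec (rk M) \<and> 0\<^sub>v (rk M) \<in> N i \<and>
        (\<forall>v\<in>N i. \<forall>w\<in>N i. v + w \<in> N i) \<and> (\<forall>c. \<forall>v\<in>N i. c \<cdot>\<^sub>v v \<in> N i) \<and>
        (\<forall>v\<in>N (i - 1). xarr M i *\<^sub>v v \<in> N i) \<and> (\<forall>v\<in>N i. yarr M i *\<^sub>v v \<in> N (i - 1)))"

text \<open>
  \<open>N / N' \<cong> Q\<close> for submodules \<open>N' \<subseteq> N\<close> of \<open>M\<close>: there is a surjective homomorphism \<open>N \<rightarrow> Q\<close>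
  with kernel \<open>N'\<close>.
\<close>

definition quotient_iso ::
  "nat \<Rightarrow> cm_rep \<Rightarrow> (int \<Rightarrow> complex fps vec set) \<Rightarrow> (int \<Rightarrow> complex fps vec set) \<Rightarrow> cm_rep \<Rightarrow> bool"
where
  "quotient_iso n M N N' Q \<longleftrightarrow>
     (\<exists>\<phi> :: int \<Rightarrow> complex fps vec \<Rightarrow> complex fps vec. periodic n \<phi> \<and>
        (\<forall>i. \<phi> i ` N i = carrier_vec (rk Q) \<and>
           {v \<in> N i. \<phi> i v = 0\<^sub>v (rk Q)} = N' i \<and>
           (\<forall>v\<in>N i. \<forall>w\<in>N i. \<phi> i (v + w) = \<phi> i v + \<phi> i w) \<and>
           (\<forall>c. \<forall>v\<in>N i. \<phi> i (c \<cdot>\<^sub>v v) = c \<cdot>\<^sub>v \<phi> i v) \<and>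
           (\<forall>v\<in>N (i - 1). \<phi> i (xarr M i *\<^sub>v v) = xarr Q i *\<^sub>v \<phi> (i - 1) v) \<and>
           (\<forall>v\<in>N i. \<phi> (i - 1) (yarr M i *\<^sub>v v) = yarr Q i *\<^sub>v \<phi> i v)))"

text \<open>
  A filtration \<open>0 = F 0 \<subseteq> \<dots> \<subseteq> F m = M\<close>.  The list \<open>P\<close> enumerates the factors from top to
  bottom: its head belongs to the quotient \<open>M / F (m - 1)\<close>, its last entry to the submodule \<open>F 1\<close>.
\<close>

definition rank_one_filtration ::
  "nat \<Rightarrow> nat \<Rightarrow> cm_rep \<Rightarrow> (nat \<Rightarrow> int \<Rightarrow> complex fps vec set) \<Rightarrow> int set list \<Rightarrow> bool"
where
  "rank_one_filtration k n M F P \<longleftrightarrow> length P = rk M \<and> (\<forall>I\<in>set P. k_subset k n I) \<and>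
     (\<forall>j\<le>rk M. cm_submodule n M (F j)) \<and>
     (\<forall>i. F 0 i = {0\<^sub>v (rk M)}) \<and> (\<forall>i. F (rk M) i = carrier_vec (rk M)) \<and>
     (\<forall>s<rk M. quotient_iso n M (F (rk M - s)) (F (rk M - s - 1)) (rank_one n (P ! s)))"

section \<open>Lattice diagrams and profiles\<close>

text \<open>
  A frame embeds all \<open>M\<^sub>i\<close> in one space \<open>K\<^sup>m\<close> so that the arrows \<open>x\<close> become inclusions (and hence
  the arrows \<open>y\<close> become multiplication by \<open>t\<close>).  Since \<open>x\<^sup>n = t\<^sup>n\<^sup>-\<^sup>k\<close>, this lives on the universal
  cover: \<open>i\<close> ranges over \<open>\<int>\<close>, and the images for \<open>i\<close> and \<open>i + n\<close> differ by the factor \<open>t\<^sup>n\<^sup>-\<^sup>k\<close>.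
\<close>

definition frame :: "cm_rep \<Rightarrow> (int \<Rightarrow> complex fls mat) \<Rightarrow> bool" where
  "frame M E \<longleftrightarrow>
     (\<forall>i. E i \<in> carrier_mat (rk M) (rk M) \<and> invertible_mat (E i) \<and>
        E i * map_mat fps_to_fls (xarr M i) = E (i - 1))"

definition frame_image :: "cm_rep \<Rightarrow> (int \<Rightarrow> complex fls mat) \<Rightarrow> int \<Rightarrow> complex fls vec set" where
  "frame_image M E i = (\<lambda>v. E i *\<^sub>v map_vec fps_to_fls v) ` carrier_vec (rk M)"

text \<open>
  The lattice points over vertex \<open>i\<close> are the pairs \<open>(i, d)\<close>, and the point \<open>(i, d)\<close> carries the
  subspace \<open>{c \<in> \<complex>\<^sup>m. t\<^sup>d c \<in> M\<^sub>i}\<close> of \<open>\<complex>\<^sup>m\<close>.  The frame is a lattice diagram when \<open>M\<close> is given by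
  this configuration of subspaces.
\<close>

definition point_space :: "cm_rep \<Rightarrow> (int \<Rightarrow> complex fls mat) \<Rightarrow> int \<Rightarrow> int \<Rightarrow> complex vec set" where
  "point_space M E i d =
     {c \<in> carrier_vec (rk M). map_vec (\<lambda>a. fls_X_intpow d * fls_const a) c \<in> frame_image M E i}"

definition lattice_diagram :: "cm_rep \<Rightarrow> (int \<Rightarrow> complex fls mat) \<Rightarrow> bool" where
  "lattice_diagram M E \<longleftrightarrow> frame M E \<and>
     (\<forall>i. frame_image M E i =
        {w \<in> carrier_vec (rk M). \<forall>d. map_vec (\<lambda>f. fls_nth f d) w \<in> point_space M E i d})"

text \<open>
  A full flag in \<open>\<complex>\<^sup>m\<close>, given by the columns of an invertible matrix \<open>g\<close>, induces a filtration of
  \<open>M\<close> by intersecting with the subspaces of \<open>K\<^sup>m\<close> spanned by the first \<open>j\<close> columns.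
\<close>

definition flag_filtration ::
  "cm_rep \<Rightarrow> (int \<Rightarrow> complex fls mat) \<Rightarrow> complex mat \<Rightarrow> nat \<Rightarrow> int \<Rightarrow> complex fps vec set"
where
  "flag_filtration M E g j i = {v \<in> carrier_vec (rk M).
     \<exists>u \<in> carrier_vec (rk M). (\<forall>r. j \<le> r \<and> r < rk M \<longrightarrow> u $ r = 0) \<and>
       E i *\<^sub>v map_vec fps_to_fls v = map_mat fls_const g *\<^sub>v u}"

inductive polynomial_map :: "nat \<Rightarrow> (complex mat \<Rightarrow> complex) \<Rightarrow> bool" for m where
  const: "polynomial_map m (\<lambda>g. c)"
| coord: "a < m \<Longrightarrow> b < m \<Longrightarrow> polynomial_map m (\<lambda>g. g $$ (a, b))"
| add: "polynomial_map m f \<Longrightarrow> polynomial_map m h \<Longrightarrow> polynomial_map m (\<lambda>g. f g + h g)"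
| mult: "polynomial_map m f \<Longrightarrow> polynomial_map m h \<Longrightarrow> polynomial_map m (\<lambda>g. f g * h g)"

text \<open>\<open>Q\<close> holds on a nonempty Zariski open subset of \<open>GL\<^sub>m(\<complex>)\<close>.\<close>

definition generically :: "nat \<Rightarrow> (complex mat \<Rightarrow> bool) \<Rightarrow> bool" where
  "generically m Q \<longleftrightarrow>
     (\<exists>f. polynomial_map m f \<and> (\<exists>g \<in> carrier_mat m m. f g \<noteq> 0) \<and>
        (\<forall>g \<in> carrier_mat m m. invertible_mat g \<and> f g \<noteq> 0 \<longrightarrow> Q g))"

text \<open>
  The profile is read off from the filtration induced by a generic flag.  In a lattice diagram a
  generic subspace of dimension \<open>j\<close> meets the subspace at a lattice point in dimension
  \<open>max 0 (dim + j - m)\<close>, so the rim of the \<open>s\<close>-th factor from the top is the boundary of the region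
  of multiplicity at least \<open>s\<close>.  A module which admits no lattice diagram has no distinguished
  frame; for such a module every frame is allowed.
\<close>

definition has_profile :: "nat \<Rightarrow> nat \<Rightarrow> cm_rep \<Rightarrow> int set list \<Rightarrow> bool" where
  "has_profile k n M P \<longleftrightarrow>
     (\<exists>E. frame M E \<and> (lattice_diagram M E \<or> \<not> (\<exists>E'. lattice_diagram M E')) \<and>
        generically (rk M) (\<lambda>g. rank_one_filtration k n M (flag_filtration M E g) P))"

definition profiles :: "nat \<Rightarrow> nat \<Rightarrow> int set list set" where
  "profiles k n = {P. \<exists>M. indecomposable k n M \<and> has_profile k n M P}"

section \<open>Combinatorics of profiles\<close>

text \<open>The entry \<open>P\<^sub>i\<^sub>j\<close>, with both indices starting at 1.\<close>

definition entry :: "int set list \<Rightarrow> nat \<Rightarrow> nat \<Rightarrow> int" where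
  "entry P i j = sorted_list_of_set (P ! (i - 1)) ! (j - 1)"

definition weakly_column_decreasing :: "nat \<Rightarrow> int set list \<Rightarrow> bool" where
  "weakly_column_decreasing k P \<longleftrightarrow>
     (\<forall>j\<in>{1..k}. \<forall>i\<in>{1..length P - 1}. entry P i j \<ge> entry P (i + 1) j)"

definition canonical :: "nat \<Rightarrow> int set list \<Rightarrow> bool" where
  "canonical k P \<longleftrightarrow> weakly_column_decreasing k P \<and>
     (\<forall>j\<in>{2..k}. entry P (length P) j \<ge> entry P 1 (j - 1))"

definition alternating :: "int list \<Rightarrow> int list \<Rightarrow> bool" where
  "alternating a b \<longleftrightarrow>
     (\<forall>i<length a. a ! i < b ! i) \<and> (\<forall>i. i + 1 < length a \<longrightarrow> b ! i < a ! (i + 1))"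

definition r_interlacing :: "nat \<Rightarrow> int set \<Rightarrow> int set \<Rightarrow> bool" where
  "r_interlacing r J1 J2 \<longleftrightarrow>
     finite (J1 - J2) \<and> finite (J2 - J1) \<and> card (J1 - J2) = r \<and> card (J2 - J1) = r \<and>
     (let a = sorted_list_of_set (J1 - J2); b = sorted_list_of_set (J2 - J1)
      in alternating a b \<or> alternating b a)"

definition interlacing :: "int set \<Rightarrow> int set \<Rightarrow> bool" where
  "interlacing J1 J2 \<longleftrightarrow> (\<exists>r. r_interlacing r J1 J2)"

end

theory Submission
  imports Defs "Jordan_Normal_Form.Char_Poly"
begin

text \<open>
  The module category enters only through the shape of a profile: it has at least one row and all
  rows are \<open>k\<close>-subsets of \<open>[n]\<close>.  The remaining statement is about finite sets of integers.

  For a finite set \<open>A\<close> let \<open>c\<^sub>A(x)\<close> be the number of elements of \<open>A\<close> that are at most \<open>x\<close>.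
  Inequalities between entries of two \<open>k\<close>-subsets are inequalities between their counting functions:
  \<open>a\<^sub>j \<le> b\<^sub>j\<^sub>+\<^sub>d\<close> for all \<open>j\<close> means \<open>c\<^sub>B \<le> c\<^sub>A + d\<close> (lemma \<open>entries_le_iff_rank_le\<close>).  In the second
  form, discarding the common elements of \<open>A\<close> and \<open>B\<close> subtracts the same number on both sides.
  Hence the weak interleaving \<open>b\<^sub>1 \<le> a\<^sub>1 \<le> b\<^sub>2 \<le> a\<^sub>2 \<le> \<dots>\<close> of the full sets, which says
  \<open>c\<^sub>A \<le> c\<^sub>B \<le> c\<^sub>A + 1\<close>, is equivalent to the same interleaving of \<open>B - A\<close> and \<open>A - B\<close>, where
  disjointness makes all inequalities strict (lemma \<open>alternating_diff_iff_rank\<close>).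

  In a canonical profile the entries of any two rows satisfy this interleaving, because they lie
  between those of the last and the first row.  Conversely, if the first row \<open>A\<close> and the last row
  \<open>B\<close> interlace, then in either order of alternation \<open>c\<^sub>B \<le> c\<^sub>A + 1\<close>, and this is the inequality
  required of a canonical profile.
\<close>

section \<open>Rows of a profile\<close>

lemma polynomial_map_on_line:
  assumes "polynomial_map m f" and "g \<in> carrier_mat m m" and "h \<in> carrier_mat m m"
  shows "\<exists>p. \<forall>s. f (g + s \<cdot>\<^sub>m h) = poly p s"
  using assms(1)
proof induction
  case (const c)
  show ?case by (rule exI[of _ "[:c:]"]) simp
next
  case (coord a b)
  then show ?case using assms(2,3)
    by (intro exI[of _ "[:g $$ (a, b), h $$ (a, b):]"]) auto
next
  case (add f1 f2)
  then obtain p q where "\<forall>s. f1 (g + s \<cdot>\<^sub>m h) = poly p s" "\<forall>s. f2 (g + s \<cdot>\<^sub>m h) = poly q s"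
    by blast
  then show ?case by (intro exI[of _ "p + q"]) simp
next
  case (mult f1 f2)
  then obtain p q where "\<forall>s. f1 (g + s \<cdot>\<^sub>m h) = poly p s" "\<forall>s. f2 (g + s \<cdot>\<^sub>m h) = poly q s"
    by blast
  then show ?case by (intro exI[of _ "p * q"]) simp
qed

text \<open>
  \<open>GL\<^sub>m\<close> is Zariski dense in the space of matrices: on the line through \<open>g\<close> in the direction of the
  identity, both a polynomial that does not vanish at \<open>g\<close> and the characteristic polynomial have
  only finitely many zeros.  So a generic property of flags holds for at least one flag, and every
  profile belongs to an actual filtration.
\<close>

lemma generically_imp_exists:
  assumes "generically m Q"
  shows "\<exists>g. Q g"
proof -
  obtain f g where f: "polynomial_map m f" and g: "g \<in> carrier_mat m m" "f g \<noteq> 0"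
    and Q: "\<And>h. h \<in> carrier_mat m m \<Longrightarrow> invertible_mat h \<Longrightarrow> f h \<noteq> 0 \<Longrightarrow> Q h"
    using assms unfolding generically_def by blast
  obtain p where p: "\<And>s. f (g + s \<cdot>\<^sub>m (- 1\<^sub>m m)) = poly p s"
    using polynomial_map_on_line[OF f g(1), of "- 1\<^sub>m m"] by auto
  have "g + 0 \<cdot>\<^sub>m (- 1\<^sub>m m) = g"
    using g(1) by (intro eq_matI) auto
  then have "p \<noteq> 0"
    using p[of 0] g(2) by auto
  moreover have "char_poly g \<noteq> 0"
    using degree_monic_char_poly[OF g(1)] by auto
  ultimately have "finite {s. poly (p * char_poly g) s = 0}"
    by (intro poly_roots_finite) simp
  then obtain s where "s \<notin> {s. poly (p * char_poly g) s = 0}"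
    using ex_new_if_finite[OF infinite_UNIV_char_0] by blast
  then have s: "poly p s \<noteq> 0" "poly (char_poly g) s \<noteq> 0"
    by simp_all
  let ?h = "g + s \<cdot>\<^sub>m (- 1\<^sub>m m)"
  have h: "?h \<in> carrier_mat m m"
    using g(1) by simp
  have "?h = char_matrix g s"
    using g(1) unfolding char_matrix_def by (intro eq_matI) auto
  then have "det ?h \<noteq> 0"
    using s(2) eigenvalue_det[OF g(1)] eigenvalue_root_char_poly[OF g(1)] by simp
  then have "?h \<in> Units (ring_mat TYPE(complex) m ())"
    by (rule det_non_zero_imp_unit[OF h])
  then have "invertible_mat ?h"
    unfolding Units_def ring_mat_def invertible_mat_def inverts_mat_def by auto
  then show ?thesis
    using Q[OF h] p s(1) by auto
qed

lemma profiles_rows: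
  assumes "P \<in> profiles k n"
  shows "P \<noteq> []" and "\<And>I. I \<in> set P \<Longrightarrow> finite I \<and> card I = k"
proof -
  obtain M where M: "indecomposable k n M" "has_profile k n M P"
    using assms unfolding profiles_def by blast
  obtain F where "rank_one_filtration k n M F P"
    using M(2) generically_imp_exists unfolding has_profile_def by blast
  then have len: "length P = rk M" and sub: "\<forall>I\<in>set P. k_subset k n I"
    unfolding rank_one_filtration_def by blast+
  show "P \<noteq> []"
    using len M(1) unfolding indecomposable_def by auto
  show "finite I \<and> card I = k" if "I \<in> set P" for I
    using sub that unfolding k_subset_def by (auto intro: finite_subset)
qed

section \<open>Interlacing in terms of counting functions\<close>

definition rank_in :: "'a::linorder set \<Rightarrow> 'a \<Rightarrow> nat" where
  "rank_in A x = card {y \<in> A. y \<le> x}"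

lemma rank_in_le_card: "finite A \<Longrightarrow> rank_in A x \<le> card A"
  unfolding rank_in_def by (rule card_mono) auto

lemma rank_in_Diff_Int:
  assumes "finite A"
  shows "rank_in A x = rank_in (A - B) x + rank_in (A \<inter> B) x"
proof -
  have "{y \<in> A. y \<le> x} = {y \<in> A - B. y \<le> x} \<union> {y \<in> A \<inter> B. y \<le> x}"
    by auto
  then show ?thesis
    unfolding rank_in_def using assms by (simp only:) (rule card_Un_disjoint; auto)
qed

lemma nth_le_iff_less_rank_in:
  assumes "finite A" and "j < card A"
  shows "sorted_list_of_set A ! j \<le> x \<longleftrightarrow> j < rank_in A x"
proof
  let ?a = "sorted_list_of_set A"
  have len: "length ?a = card A" and set: "set ?a = A"
    using assms(1) by auto
  assume le: "?a ! j \<le> x"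
  have "inj_on ((!) ?a) {..j}"
    using assms(2) len by (intro inj_on_nth) auto
  moreover have "(!) ?a ` {..j} \<subseteq> {y \<in> A. y \<le> x}"
  proof clarify
    fix i assume "i \<le> j"
    then have "?a ! i \<le> ?a ! j" "?a ! i \<in> set ?a"
      using assms(2) len by (auto intro!: sorted_nth_mono nth_mem)
    then show "?a ! i \<in> A \<and> ?a ! i \<le> x"
      using le set by auto
  qed
  ultimately have "card {..j} \<le> rank_in A x"
    unfolding rank_in_def using assms(1) by (intro card_inj_on_le) auto
  then show "j < rank_in A x" by simp
next
  let ?a = "sorted_list_of_set A"
  have len: "length ?a = card A" and set: "set ?a = A"
    using assms(1) by auto
  assume less: "j < rank_in A x"
  show "?a ! j \<le> x"
  proof (rule ccontr)
    assume gt: "\<not> ?a ! j \<le> x"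
    have "{y \<in> A. y \<le> x} \<subseteq> (!) ?a ` {..<j}"
    proof
      fix y assume y: "y \<in> {y \<in> A. y \<le> x}"
      then have "y \<in> set ?a" using set by simp
      then obtain i where i: "i < length ?a" "y = ?a ! i"
        by (metis in_set_conv_nth)
      have "\<not> j \<le> i"
        using gt y i sorted_nth_mono[of ?a j i] by auto
      then show "y \<in> (!) ?a ` {..<j}"
        using i by auto
    qed
    then have "rank_in A x \<le> card ((!) ?a ` {..<j})"
      unfolding rank_in_def by (intro card_mono) auto
    also have "\<dots> \<le> j"
      using card_image_le[of "{..<j}" "(!) ?a"] by simp
    finally show False using less by simp
  qed
qed

text \<open>
  By \<open>nth_le_iff_less_rank_in\<close> the enumeration of a set and its counting function form a Galois
  connection, and passing to adjoints reverses inequalities.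
\<close>

lemma entries_le_iff_rank_le:
  assumes A: "finite A" and B: "finite B" and card: "card A = card B"
  shows "(\<forall>j. j + d < card B \<longrightarrow> sorted_list_of_set A ! j \<le> sorted_list_of_set B ! (j + d)) \<longleftrightarrow>
    (\<forall>x. rank_in B x \<le> rank_in A x + d)"
proof (intro iffI allI impI)
  fix x
  assume le: "\<forall>j. j + d < card B \<longrightarrow> sorted_list_of_set A ! j \<le> sorted_list_of_set B ! (j + d)"
  show "rank_in B x \<le> rank_in A x + d"
  proof (rule ccontr)
    \<comment> \<open>The first element of \<open>A\<close> exceeding \<open>x\<close> has index \<open>rank_in A x\<close>.\<close>
    let ?j = "rank_in A x"
    assume "\<not> rank_in B x \<le> ?j + d"
    then have less: "?j + d < rank_in B x" by simp
    then have j: "?j + d < card B"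
      using rank_in_le_card[OF B, of x] by simp
    then have "sorted_list_of_set B ! (?j + d) \<le> x"
      using less nth_le_iff_less_rank_in[OF B] by blast
    with le j have "sorted_list_of_set A ! ?j \<le> x"
      by (meson order_trans)
    then show False
      using nth_le_iff_less_rank_in[OF A, of ?j x] j card by simp
  qed
next
  fix j
  assume le: "\<forall>x. rank_in B x \<le> rank_in A x + d" and j: "j + d < card B"
  let ?x = "sorted_list_of_set B ! (j + d)"
  have "j + d < rank_in B ?x"
    using nth_le_iff_less_rank_in[OF B j, of ?x] by simp
  also have "\<dots> \<le> rank_in A ?x + d"
    using le by blast
  finally show "sorted_list_of_set A ! j \<le> ?x"
    using nth_le_iff_less_rank_in[OF A, of j ?x] j card by simp
qed

text \<open>
  The two sets of differences are disjoint, so strict and weak inequalities between their elements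
  agree; the common part contributes equally to both counting functions.
\<close>

lemma alternating_diff_iff_rank:
  assumes A: "finite A" and B: "finite B" and card: "card A = card B"
  shows "alternating (sorted_list_of_set (B - A)) (sorted_list_of_set (A - B)) \<longleftrightarrow>
    (\<forall>x. rank_in A x \<le> rank_in B x \<and> rank_in B x \<le> rank_in A x + 1)"
proof -
  let ?a = "sorted_list_of_set (A - B)" and ?b = "sorted_list_of_set (B - A)"
  have eq: "card (B - A) = card (A - B)"
    using card_Diff_subset_Int[of A B] card_Diff_subset_Int[of B A] A B card
    by (simp add: Int_commute)
  have neq: "?b ! i \<noteq> ?a ! j" if "i < card (B - A)" "j < card (B - A)" for i j
  proof -
    have "?b ! i \<in> set ?b" "?a ! j \<in> set ?a"
      using that eq by (simp_all only: nth_mem length_sorted_list_of_set)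
    then show ?thesis using A B by auto
  qed
  have "?b ! i < ?a ! i \<longleftrightarrow> ?b ! i \<le> ?a ! i" if "i < card (A - B)" for i
    using neq[of i i] that eq by auto
  moreover have "?a ! i < ?b ! (i + 1) \<longleftrightarrow> ?a ! i \<le> ?b ! (i + 1)" if "i + 1 < card (A - B)" for i
    using neq[of "i + 1" i] that eq by auto
  ultimately have "alternating ?b ?a \<longleftrightarrow>
      (\<forall>i. i + 0 < card (A - B) \<longrightarrow> ?b ! i \<le> ?a ! (i + 0)) \<and>
      (\<forall>i. i + 1 < card (B - A) \<longrightarrow> ?a ! i \<le> ?b ! (i + 1))"
    unfolding alternating_def using eq by simp
  also have "\<dots> \<longleftrightarrow> (\<forall>x. rank_in (A - B) x \<le> rank_in (B - A) x + 0) \<and>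
      (\<forall>x. rank_in (B - A) x \<le> rank_in (A - B) x + 1)"
    using entries_le_iff_rank_le[of "B - A" "A - B" 0] entries_le_iff_rank_le[of "A - B" "B - A" 1]
      A B eq by simp
  also have "\<dots> \<longleftrightarrow> (\<forall>x. rank_in A x \<le> rank_in B x \<and> rank_in B x \<le> rank_in A x + 1)"
    using rank_in_Diff_Int[OF A, of _ B] rank_in_Diff_Int[OF B, of _ A]
    by (auto simp: Int_commute)
  finally show ?thesis .
qed

lemma interlacing_iff_rank:
  assumes A: "finite A" and B: "finite B" and card: "card A = card B"
  shows "interlacing A B \<longleftrightarrow>
    (\<forall>x. rank_in A x \<le> rank_in B x \<and> rank_in B x \<le> rank_in A x + 1) \<or>
    (\<forall>x. rank_in B x \<le> rank_in A x \<and> rank_in A x \<le> rank_in B x + 1)"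
proof -
  have "card (A - B) = card (B - A)"
    using card_Diff_subset_Int[of A B] card_Diff_subset_Int[of B A] A B card
    by (simp add: Int_commute)
  then show ?thesis
    using alternating_diff_iff_rank[OF A B card] alternating_diff_iff_rank[OF B A card[symmetric]] A B
    unfolding interlacing_def r_interlacing_def Let_def by auto
qed

section \<open>Canonical profiles\<close>

lemma weakly_column_decreasing_antimono:
  assumes dec: "weakly_column_decreasing k P" and j: "j \<in> {1..k}"
    and "1 \<le> i" and "i \<le> i'" and "i' \<le> length P"
  shows "entry P i' j \<le> entry P i j"
  using assms(4,5)
proof (induction rule: dec_induct)
  case base
  show ?case by simp
next
  case (step l)
  have "entry P (l + 1) j \<le> entry P l j"
    using dec j step \<open>1 \<le> i\<close> unfolding weakly_column_decreasing_def by auto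
  then show ?case using step by simp
qed

lemma canonical_imp_interlacing_ordered:
  assumes can: "canonical k P" and rows: "\<And>I. I \<in> set P \<Longrightarrow> finite I \<and> card I = k"
    and i: "i \<le> i'" "i' < length P"
  shows "interlacing (P ! i) (P ! i')"
proof -
  let ?A = "P ! i" and ?B = "P ! i'"
  have dec: "weakly_column_decreasing k P"
    using can unfolding canonical_def by blast
  have A: "finite ?A" "card ?A = k" and B: "finite ?B" "card ?B = k"
    using rows i by auto
  have "sorted_list_of_set ?B ! j \<le> sorted_list_of_set ?A ! j" if "j < k" for j
    using weakly_column_decreasing_antimono[OF dec, of "j + 1" "i + 1" "i' + 1"] i that
    by (simp add: entry_def)
  then have "\<forall>x. rank_in ?A x \<le> rank_in ?B x"
    using entries_le_iff_rank_le[of ?B ?A 0] A B by simp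
  moreover have "sorted_list_of_set ?A ! j \<le> sorted_list_of_set ?B ! (j + 1)" if "j + 1 < k" for j
  proof -
    have "entry P (i + 1) (j + 1) \<le> entry P 1 (j + 1)"
      using weakly_column_decreasing_antimono[OF dec, of "j + 1" 1 "i + 1"] i that by simp
    also have "\<dots> \<le> entry P (length P) (j + 2)"
      using can that unfolding canonical_def by (force dest!: bspec[of _ _ "j + 2"])
    also have "\<dots> \<le> entry P (i' + 1) (j + 2)"
      using weakly_column_decreasing_antimono[OF dec, of "j + 2" "i' + 1" "length P"] i that by simp
    finally show ?thesis by (simp add: entry_def)
  qed
  then have "\<forall>x. rank_in ?B x \<le> rank_in ?A x + 1"
    using entries_le_iff_rank_le[of ?A ?B 1] A B by simp
  ultimately show ?thesis
    using interlacing_iff_rank[of ?A ?B] A B by simp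
qed

text \<open>
  For the first row \<open>A\<close> and the last row \<open>B\<close>, one order of alternation contains
  \<open>c\<^sub>B \<le> c\<^sub>A + 1\<close>, which compares each entry of \<open>A\<close> with the next entry of \<open>B\<close>; the other order
  gives even \<open>c\<^sub>B \<le> c\<^sub>A\<close>.
\<close>

lemma interlacing_imp_canonical:
  assumes dec: "weakly_column_decreasing k P" and ne: "P \<noteq> []"
    and rows: "\<And>I. I \<in> set P \<Longrightarrow> finite I \<and> card I = k"
    and inter: "interlacing (hd P) (last P)"
  shows "canonical k P"
proof -
  let ?A = "hd P" and ?B = "last P"
  have A: "finite ?A" "card ?A = k" and B: "finite ?B" "card ?B = k"
    using rows ne by auto
  have "\<forall>x. rank_in ?B x \<le> rank_in ?A x + 1"
    using inter interlacing_iff_rank[of ?A ?B] A B by (auto intro: le_SucI)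
  then have le: "\<forall>j. j + 1 < k \<longrightarrow> sorted_list_of_set ?A ! j \<le> sorted_list_of_set ?B ! (j + 1)"
    using entries_le_iff_rank_le[of ?A ?B 1] A B by simp
  have "entry P 1 (j - 1) \<le> entry P (length P) j" if "j \<in> {2..k}" for j
  proof -
    have "j - 1 - 1 + 1 = j - 1" "j - 1 - 1 + 1 < k"
      using that by auto
    then show ?thesis
      using le[rule_format, of "j - 1 - 1"] ne by (simp add: entry_def hd_conv_nth last_conv_nth)
  qed
  then show ?thesis
    using dec unfolding canonical_def by blast
qed

theorem proposition3p7:
  fixes n k :: nat and P :: "int set list"
  assumes "n \<ge> 4" and "1 \<le> k" and "2 * k \<le> n"
    and "P \<in> profiles k n"
    and "weakly_column_decreasing k P"
  shows "canonical k P \<longleftrightarrow> (\<forall>I\<in>set P. \<forall>J\<in>set P. interlacing I J)"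
proof
  note rows = profiles_rows[OF \<open>P \<in> profiles k n\<close>]
  assume can: "canonical k P"
  show "\<forall>I\<in>set P. \<forall>J\<in>set P. interlacing I J"
  proof (intro ballI)
    fix I J assume IJ: "I \<in> set P" "J \<in> set P"
    then obtain i j where ij: "i < length P" "I = P ! i" "j < length P" "J = P ! j"
      by (metis in_set_conv_nth)
    then have "interlacing I J \<or> interlacing J I"
      using canonical_imp_interlacing_ordered[OF can rows(2)] by (metis nle_le)
    then show "interlacing I J"
      using interlacing_iff_rank[of I J] interlacing_iff_rank[of J I] rows(2)[OF IJ(1)] rows(2)[OF IJ(2)]
      by auto
  qed
next
  note rows = profiles_rows[OF \<open>P \<in> profiles k n\<close>]
  assume "\<forall>I\<in>set P. \<forall>J\<in>set P. interlacing I J"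
  then show "canonical k P"
    using interlacing_imp_canonical[OF \<open>weakly_column_decreasing k P\<close> rows] rows(1) by simp
qed

end
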